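(* Let $k>l\geq 1$. For any $\tau\in U_l^k$ that avoids $132$, $$F_{U_l^k\backslash\{\tau\};\tau}(x)=\frac{x^l}{\left( U_{k-l}\left(\frac{1}{2\sqrt{x}}\right) -\sqrt{x}\,E(x)\,U_{k-1-l}\left(\frac{1}{2\sqrt{x}}\right)\right)^2},$$ where $E(x)=\sum_{j=0}^{l-1} c_jx^j$ and $c_j$ is the $j$th Catalan number.
   Context: $S_n$ is the set of permutations of $\{1,\dots,n\}$ written as words ($S_0$ consists of the empty permutation). An occurrence of a pattern $\tau\in S_k$ in $\rho\in S_n$ is a choice of indices $1\le i_1<\dots<i_k\le n$ with $(\rho_{i_1},\dots,\rho_{i_k})$ order-isomorphic to $\tau$; $\rho$ avoids $\tau$ if it has no occurrence of $\tau$. For a set $A$ of patterns and a pattern $\tau$, $F_{A;\tau}(x)=\sum_{n\ge0} a_n x^n$, where $a_n$ is the number of $\rho\in S_n$ that avoid $132$, avoid every pattern in $A$, and contain exactly one occurrence of $\tau$. For $k\ge l\ge 1$, the symbol $U_l^k$ (with both a subscript and a superscript) denotes the set of all permutations $\tau\in S_k$ such that $(\tau_{l+1},\tau_{l+2},\dots,\tau_k)=(l+1,l+2,\dots,k)$. By contrast, $U_m(t)$ with a single index denotes the $m$th Chebyshev polynomial of the second kind: $U_0(t)=1$, $U_1(t)=2t$, $U_m(t)=2tU_{m-1}(t)-U_{m-2}(t)$ for $m\ge2$. In the claim, the square is the ordinary square of the bracketed expression, and the identity is one of formal Laurent series in $\sqrt{x}$. The Catalan numbers are $c_j=\frac{1}{j+1}\binom{2j}{j}$.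 *)

theory Defs
  imports
    "HOL-Combinatorics.Multiset_Permutations"
    "HOL-Computational_Algebra.Formal_Laurent_Series"
begin

abbreviation perms :: "nat \<Rightarrow> nat list set"
  where "perms n \<equiv> permutations_of_set {1..n}"

definition order_isomorphic :: "nat list \<Rightarrow> nat list \<Rightarrow> bool"
  where "order_isomorphic u v \<longleftrightarrow> length u = length v \<and>
    (\<forall>i<length u. \<forall>j<length u. u ! i < u ! j \<longleftrightarrow> v ! i < v ! j)"

(* An occurrence is given by its index sequence i_1 < ... < i_k; list positions start at 0. *)
definition occurrences :: "nat list \<Rightarrow> nat list \<Rightarrow> nat list set"
  where "occurrences \<tau> \<rho> = {is. sorted_wrt (<) is \<and> set is \<subseteq> {..<length \<rho>} \<and>
    order_isomorphic (map (\<lambda>i. \<rho> ! i) is) \<tau>}"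

definition avoids :: "nat list \<Rightarrow> nat list \<Rightarrow> bool"
  where "avoids \<rho> \<tau> \<longleftrightarrow> occurrences \<tau> \<rho> = {}"

definition F :: "nat list set \<Rightarrow> nat list \<Rightarrow> rat fps"
  where "F A \<tau> = Abs_fps (\<lambda>n. of_nat (card {\<rho> \<in> perms n.
    avoids \<rho> [1, 3, 2] \<and> (\<forall>\<sigma>\<in>A. avoids \<rho> \<sigma>) \<and> card (occurrences \<tau> \<rho>) = 1}))"

definition pattern_set :: "nat \<Rightarrow> nat \<Rightarrow> nat list set"
  where "pattern_set l k = {\<tau> \<in> perms k. drop l \<tau> = [l + 1..<k + 1]}"

fun chebyshev_U :: "nat \<Rightarrow> 'a::comm_ring_1 \<Rightarrow> 'a" where
  "chebyshev_U 0 t = 1"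
| "chebyshev_U (Suc 0) t = 2 * t"
| "chebyshev_U (Suc (Suc m)) t = 2 * t * chebyshev_U (Suc m) t - chebyshev_U m t"

definition catalan :: "nat \<Rightarrow> rat"
  where "catalan j = of_nat ((2 * j) choose j) / of_nat (j + 1)"

(* Laurent series in the square root of x: the variable of the type rat fls plays the role
   of this root, and x itself is its square. *)
abbreviation sqrt_x :: "rat fls"
  where "sqrt_x \<equiv> fls_X"

abbreviation var_x :: "rat fls"
  where "var_x \<equiv> sqrt_x ^ 2"

(* f(x), for a power series f in x, as a Laurent series in the square root of x. *)
definition series_at_x :: "rat fps \<Rightarrow> rat fls"
  where "series_at_x f = fps_to_fls (f oo fps_X ^ 2)"

definition E :: "nat \<Rightarrow> rat fls"
  where "E l = (\<Sum>j = 0..l - 1. fls_const (catalan j) * var_x ^ j)"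

end

theory Submission
  imports Defs "HOL-Library.Sublist"
begin

text \<open>
  Since every permutation in the family has a standardised copy, the condition counted by
  \<open>F\<close> says that \<open>\<rho>\<close> has exactly one subsequence of length \<open>k\<close> each of whose last \<open>m = k - l\<close>
  entries exceeds everything before it, and that this subsequence is order-isomorphic to \<open>\<tau>\<close>.
  A nonempty 132-avoiding permutation is \<open>a N b\<close> with \<open>N\<close> its maximum and all of \<open>a\<close> above
  all of \<open>b\<close>; such a subsequence lies in \<open>a\<close>, lies in \<open>b\<close>, or is a shorter one in \<open>a\<close>
  followed by \<open>N\<close>. With \<open>G\<^sub>m\<close> and \<open>H\<^sub>m\<close> counting the permutations with no such subsequence
  and with exactly one, this yields \<open>G\<^sub>m = 1 + x G\<^bsub>m-1\<^esub> G\<^sub>m\<close> and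
  \<open>H\<^sub>m = x (G\<^bsub>m-1\<^esub> H\<^sub>m + H\<^bsub>m-1\<^esub> G\<^sub>m)\<close>, hence \<open>H\<^sub>m = x H\<^bsub>m-1\<^esub> G\<^sub>m\<^sup>2\<close>, starting from
  \<open>G\<^sub>0 = E\<close> and \<open>H\<^sub>0 = x\<^sup>l\<close>. If \<open>V\<^sub>m\<close> is the bracketed expression of the claim, the Chebyshev recurrence gives
  \<open>\<surd>x G\<^sub>m V\<^sub>m = V\<^bsub>m-1\<^esub>\<close>, so that \<open>H\<^sub>m V\<^sub>m\<^sup>2\<close> does not depend on \<open>m\<close>.
\<close>

section \<open>Occurrences as subsequences\<close>

lemma nths_eq_map_nth_filter: "nths xs A = map ((!) xs) (filter (\<lambda>i. i \<in> A) [0..<length xs])"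
proof -
  have "nths xs A = nths (map ((!) xs) [0..<length xs]) A"
    by (simp add: map_nth)
  also have "\<dots> = map ((!) xs) (nths [0..<length xs] A)"
    by (rule nths_map)
  also have "nths [0..<length xs] A = filter (\<lambda>i. i \<in> A) [0..<length xs]"
    by (simp add: nths_def zip_same_conv_map filter_map comp_def)
  finally show ?thesis .
qed

lemma subseq_iff_indices:
  "subseq s xs \<longleftrightarrow> (\<exists>is. sorted_wrt (<) is \<and> set is \<subseteq> {..<length xs} \<and> s = map ((!) xs) is)"
proof
  assume "subseq s xs"
  then obtain A where "s = nths xs A"
    by (auto simp: subseq_conv_nths)
  then show "\<exists>is. sorted_wrt (<) is \<and> set is \<subseteq> {..<length xs} \<and> s = map ((!) xs) is"
    by (intro exI[of _ "filter (\<lambda>i. i \<in> A) [0..<length xs]"])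
      (auto simp: nths_eq_map_nth_filter sorted_wrt_filter)
next
  assume "\<exists>is. sorted_wrt (<) is \<and> set is \<subseteq> {..<length xs} \<and> s = map ((!) xs) is"
  then obtain ks where ks: "sorted_wrt (<) ks" "set ks \<subseteq> {..<length xs}" "s = map ((!) xs) ks"
    by blast
  have "filter (\<lambda>i. i \<in> set ks) [0..<length xs] = ks"
    by (rule strict_sorted_equal) (use ks in \<open>auto simp: sorted_wrt_filter\<close>)
  then show "subseq s xs"
    unfolding subseq_conv_nths by (intro exI[of _ "set ks"]) (simp add: nths_eq_map_nth_filter ks(3))
qed

lemma subseq_distinct: "subseq s xs \<Longrightarrow> distinct xs \<Longrightarrow> distinct s"
  by (auto simp: subseq_conv_nths)

lemma subseq_set: "subseq s xs \<Longrightarrow> set s \<subseteq> set xs"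
  by (auto simp: subseq_conv_nths dest: in_set_nthsD)

lemma subseq_map_iff: "subseq s (map f xs) \<longleftrightarrow> (\<exists>t. subseq t xs \<and> s = map f t)"
  by (auto simp: subseq_conv_nths nths_map)

lemma image_occurrences:
  "map ((!) \<rho>) ` occurrences \<tau> \<rho> = {s. subseq s \<rho> \<and> order_isomorphic s \<tau>}"
  by (auto simp: occurrences_def subseq_iff_indices)

text \<open>In a word without repeated letters the selected letters determine their positions, so
  occurrences can be counted as subsequences instead of index sequences.\<close>

lemma inj_on_occurrences:
  assumes "distinct \<rho>"
  shows "inj_on (map ((!) \<rho>)) (occurrences \<tau> \<rho>)"
proof (rule inj_onI)
  fix ks js assume "ks \<in> occurrences \<tau> \<rho>" "js \<in> occurrences \<tau> \<rho>"
    and eq: "map ((!) \<rho>) ks = map ((!) \<rho>) js"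
  then have "set ks \<subseteq> {..<length \<rho>}" "set js \<subseteq> {..<length \<rho>}"
    by (auto simp: occurrences_def)
  then have "inj_on ((!) \<rho>) (set ks \<union> set js)"
    using assms by (auto simp: inj_on_def nth_eq_iff_index_eq subset_iff)
  then show "ks = js"
    using eq by (simp add: inj_on_map_eq_map)
qed

lemma avoids_iff: "avoids \<rho> \<tau> \<longleftrightarrow> (\<forall>s. subseq s \<rho> \<longrightarrow> \<not> order_isomorphic s \<tau>)"
  using image_occurrences[of \<rho> \<tau>] by (auto simp: avoids_def)

lemma card_occurrences_eq_1_iff:
  assumes "distinct \<rho>"
  shows "card (occurrences \<tau> \<rho>) = 1 \<longleftrightarrow> (\<exists>s. {s. subseq s \<rho> \<and> order_isomorphic s \<tau>} = {s})"
  using card_image[OF inj_on_occurrences[OF assms, of \<tau>]]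
  by (simp add: image_occurrences flip: card_1_singleton_iff)

lemma order_isomorphic_refl: "order_isomorphic s s"
  by (simp add: order_isomorphic_def)

lemma order_isomorphic_sym: "order_isomorphic s t \<Longrightarrow> order_isomorphic t s"
  by (simp add: order_isomorphic_def)

lemma order_isomorphic_trans:
  "order_isomorphic s t \<Longrightarrow> order_isomorphic t u \<Longrightarrow> order_isomorphic s u"
  by (simp add: order_isomorphic_def)

lemma order_isomorphic_map:
  assumes "\<And>x y. x \<in> set s \<Longrightarrow> y \<in> set s \<Longrightarrow> f x < f y \<longleftrightarrow> x < y"
  shows "order_isomorphic (map f s) s"
  using assms by (simp add: order_isomorphic_def)

text \<open>Lets a dominating last letter be removed from a pattern and its occurrence together,
  which is what the recursion on \<open>m\<close> does.\<close>

lemma order_isomorphic_snoc: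
  assumes "\<forall>y\<in>set s. y < x" "\<forall>y\<in>set t. y < x'"
  shows "order_isomorphic (s @ [x]) (t @ [x']) \<longleftrightarrow> order_isomorphic s t"
proof -
  have "(s @ [x]) ! i < (s @ [x]) ! j \<longleftrightarrow> (t @ [x']) ! i < (t @ [x']) ! j"
    if "order_isomorphic s t" "i < Suc (length s)" "j < Suc (length s)" for i j
  proof -
    have len: "length s = length t" using that by (simp add: order_isomorphic_def)
    have "s ! i < x" "t ! i < x'" if "i < length s" for i
      using assms that len by auto
    with that len show ?thesis
      by (auto simp: order_isomorphic_def nth_append less_Suc_eq dest: less_not_sym)
  qed
  moreover have "order_isomorphic s t" if "order_isomorphic (s @ [x]) (t @ [x'])"
    unfolding order_isomorphic_def
  proof (intro conjI allI impI)
    show len: "length s = length t" using that by (simp add: order_isomorphic_def)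
    fix i j assume ij: "i < length s" "j < length s"
    from that have "(s @ [x]) ! i < (s @ [x]) ! j \<longleftrightarrow> (t @ [x']) ! i < (t @ [x']) ! j"
      using ij by (simp add: order_isomorphic_def)
    then show "s ! i < s ! j \<longleftrightarrow> t ! i < t ! j"
      using ij len by (simp add: nth_append)
  qed
  ultimately show ?thesis
    by (auto simp: order_isomorphic_def)
qed

section \<open>Standardisation of words\<close>

text \<open>Ranks are counted with \<le>, so they start at 1 as in \<open>perms\<close>.\<close>

definition standardize :: "nat list \<Rightarrow> nat list"
  where "standardize s = map (\<lambda>x. card {y \<in> set s. y \<le> x}) s"

lemma standardize_less_iff:
  fixes x z :: nat
  assumes "x \<in> set s" "z \<in> set s"
  shows "card {y \<in> set s. y \<le> x} < card {y \<in> set s. y \<le> z} \<longleftrightarrow> x < z"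
proof -
  have *: "card {y \<in> set s. y \<le> x} < card {y \<in> set s. y \<le> z}" if "x < z" "z \<in> set s" for x z :: nat
  proof (rule psubset_card_mono)
    have "z \<in> {y \<in> set s. y \<le> z} - {y \<in> set s. y \<le> x}" using that by simp
    moreover have "{y \<in> set s. y \<le> x} \<subseteq> {y \<in> set s. y \<le> z}" using that(1) by auto
    ultimately show "{y \<in> set s. y \<le> x} \<subset> {y \<in> set s. y \<le> z}" by blast
  qed simp
  show ?thesis
    using *[of x z] *[of z x] assms by (cases x z rule: linorder_cases) auto
qed

lemma order_isomorphic_standardize: "order_isomorphic (standardize s) s"
  unfolding standardize_def by (rule order_isomorphic_map) (simp add: standardize_less_iff)

lemma standardize_in_perms:
  assumes "distinct s"
  shows "standardize s \<in> perms (length s)"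
proof -
  have inj: "inj_on (\<lambda>x. card {y \<in> set s. y \<le> x}) (set s)"
  proof (rule inj_onI)
    fix x z assume "x \<in> set s" "z \<in> set s" "card {y \<in> set s. y \<le> x} = card {y \<in> set s. y \<le> z}"
    then show "x = z"
      using standardize_less_iff[of x s z] standardize_less_iff[of z s x] by auto
  qed
  then have d: "distinct (standardize s)"
    using assms by (simp add: standardize_def distinct_map)
  have "set (standardize s) \<subseteq> {1..length s}"
  proof
    fix c assume "c \<in> set (standardize s)"
    then obtain x where x: "x \<in> set s" and c: "c = card {y \<in> set s. y \<le> x}"
      by (auto simp: standardize_def)
    have "card {x} \<le> c" unfolding c by (rule card_mono) (use x in auto)
    moreover have "c \<le> card (set s)" unfolding c by (rule card_mono) auto
    ultimately show "c \<in> {1..length s}"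
      using distinct_card[OF assms] by auto
  qed
  moreover have "card (set (standardize s)) = length s"
    using distinct_card[OF d] by (simp add: standardize_def)
  ultimately have "set (standardize s) = {1..length s}"
    by (intro card_subset_eq) auto
  with d show ?thesis by auto
qed

text \<open>Expresses a rank through positions, the only data that \<open>order_isomorphic\<close>
  compares.\<close>

lemma card_le_conv_indices:
  assumes "distinct s"
  shows "card {y \<in> set s. y \<le> x} = card {j. j < length s \<and> s ! j \<le> x}"
proof -
  have "{y \<in> set s. y \<le> x} = (!) s ` {j. j < length s \<and> s ! j \<le> x}"
    by (auto simp: in_set_conv_nth image_iff) 
  moreover have "inj_on ((!) s) {j. j < length s \<and> s ! j \<le> x}"
    using assms by (auto simp: inj_on_def nth_eq_iff_index_eq)
  ultimately show ?thesis by (simp add: card_image)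
qed

lemma standardize_cong:
  assumes "order_isomorphic s t" "distinct s" "distinct t"
  shows "standardize s = standardize t"
proof (rule nth_equalityI)
  show len: "length (standardize s) = length (standardize t)"
    using assms by (simp add: standardize_def order_isomorphic_def)
  fix i assume i: "i < length (standardize s)"
  then have i': "i < length s" "i < length t" using len by (simp_all add: standardize_def)
  have "s ! j \<le> s ! i \<longleftrightarrow> t ! j \<le> t ! i" if "j < length s" for j
    using assms(1) that i' by (auto simp: order_isomorphic_def simp flip: not_less)
  then have "{j. j < length s \<and> s ! j \<le> s ! i} = {j. j < length t \<and> t ! j \<le> t ! i}"
    using len by (auto simp: standardize_def)
  then show "standardize s ! i = standardize t ! i"
    using i' assms by (simp add: standardize_def card_le_conv_indices)
qed

lemma standardize_perm:
  assumes "\<sigma> \<in> perms n"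
  shows "standardize \<sigma> = \<sigma>"
  unfolding standardize_def
proof (rule map_idI)
  fix x assume "x \<in> set \<sigma>"
  then have "{y \<in> set \<sigma>. y \<le> x} = {1..x}"
    using permutations_of_setD(1)[OF assms] by auto
  then show "card {y \<in> set \<sigma>. y \<le> x} = x" by simp
qed

text \<open>Standardisation is invariant under order isomorphism and fixes every permutation. Hence
  one subsequence cannot be an occurrence of two different patterns of the family.\<close>

lemma order_isomorphic_perms_eq:
  assumes "order_isomorphic \<sigma> \<tau>" "\<sigma> \<in> perms n" "\<tau> \<in> perms m"
  shows "\<sigma> = \<tau>"
  using standardize_cong[OF assms(1)] standardize_perm[OF assms(2)] standardize_perm[OF assms(3)]
    permutations_of_setD(2)[OF assms(2)] permutations_of_setD(2)[OF assms(3)] by simp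

section \<open>132-avoiding permutations\<close>

lemma subseq_snoc_iff: "subseq s (p @ [N]) \<longleftrightarrow> subseq s p \<or> (\<exists>s'. s = s' @ [N] \<and> subseq s' p)"
proof
  assume "subseq s (p @ [N])"
  then obtain s1 s2 where s: "s = s1 @ s2" "subseq s1 p" "subseq s2 [N]"
    by (rule subseq_appendE)
  from s(3) have "s2 = [] \<or> s2 = [N]"
    by (cases s2) (simp_all split: if_splits)
  with s show "subseq s p \<or> (\<exists>s'. s = s' @ [N] \<and> subseq s' p)" by auto
next
  assume "subseq s p \<or> (\<exists>s'. s = s' @ [N] \<and> subseq s' p)"
  then show "subseq s (p @ [N])" by (auto intro: list_emb_append_mono)
qed

text \<open>A subsequence that meets both \<open>p @ [N]\<close> and \<open>q\<close> starts above
  its own last letter. Both 132 and the family patterns with a nonempty increasing tail have first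
  letter \<le> last letter, so this case split serves both.\<close>

lemma subseq_hd_le_last_cases:
  fixes N :: nat
  assumes "subseq s (p @ N # q)" "s \<noteq> []" "hd s \<le> last s"
    and "\<forall>x\<in>set p \<union> {N}. \<forall>y\<in>set q. y < x"
  obtains "subseq s p" | s' where "s = s' @ [N]" "subseq s' p" | "subseq s q"
proof -
  from assms(1) have "subseq s ((p @ [N]) @ q)" by simp
  then obtain s1 s2 where s: "s = s1 @ s2" "subseq s1 (p @ [N])" "subseq s2 q"
    by (rule subseq_appendE)
  show thesis
  proof (cases "s1 = [] \<or> s2 = []")
    case True
    with s that show thesis by (auto simp: subseq_snoc_iff)
  next
    case False
    then have "hd s \<in> set s1" "last s \<in> set s2"
      using s(1) by auto
    then have "hd s \<in> set p \<union> {N}" "last s \<in> set q"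
      using subseq_set[OF s(2)] subseq_set[OF s(3)] by auto
    then have "last s < hd s" using assms(4) by blast
    with assms(3) show thesis by simp
  qed
qed

lemma avoids_132_iff:
  "avoids \<rho> [1, 3, 2] \<longleftrightarrow> \<not> (\<exists>x y z. subseq [x, z, y] \<rho> \<and> x < y \<and> y < z)"
proof -
  have *: "order_isomorphic s [1, 3, 2] \<longleftrightarrow> (\<exists>x y z. s = [x, z, y] \<and> x < y \<and> y < z)" for s
  proof
    assume s: "order_isomorphic s [1, 3, 2]"
    then have "length s = 3" by (simp add: order_isomorphic_def)
    then obtain x z y where "s = [x, z, y]"
      by (auto simp: numeral_3_eq_3 length_Suc_conv)
    moreover have "x < y \<and> y < z"
    proof -
      from s have *: "\<forall>i<length s. \<forall>j<length s. s ! i < s ! j \<longleftrightarrow> [1, 3, 2::nat] ! i < [1, 3, 2] ! j"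
        unfolding order_isomorphic_def by blast
      show ?thesis
        using *[rule_format, of 0 2] *[rule_format, of 2 1] by (simp add: \<open>s = [x, z, y]\<close>)
    qed
    ultimately show "\<exists>x y z. s = [x, z, y] \<and> x < y \<and> y < z" by blast
  next
    assume "\<exists>x y z. s = [x, z, y] \<and> x < y \<and> y < z"
    then obtain x y z where "s = [x, z, y]" "x < y" "y < z" by blast
    then show "order_isomorphic s [1, 3, 2]"
      by (auto simp: order_isomorphic_def less_Suc_eq)
  qed
  show ?thesis unfolding avoids_iff * by blast
qed

lemma avoids_subseq: "avoids \<rho> \<tau> \<Longrightarrow> subseq \<pi> \<rho> \<Longrightarrow> avoids \<pi> \<tau>"
  unfolding avoids_iff using subseq_order.order_trans by blast

lemma avoids_132_append_Cons:
  assumes "\<forall>x\<in>set p \<union> {N}. \<forall>y\<in>set q. y < x" "\<forall>x\<in>set p. x < N"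
    and "avoids p [1, 3, 2]" "avoids q [1, 3, 2]"
  shows "avoids (p @ N # q) [1, 3, 2]"
  unfolding avoids_132_iff
proof (intro notI, elim exE conjE)
  fix x y z assume s: "subseq [x, z, y] (p @ N # q)" and xyz: "x < y" "y < z"
  from s show False
  proof (rule subseq_hd_le_last_cases)
    show "False" if "subseq [x, z, y] p"
      using that xyz assms(3) unfolding avoids_132_iff by blast
    show "False" if "subseq [x, z, y] q"
      using that xyz assms(4) unfolding avoids_132_iff by blast
    show "False" if "[x, z, y] = s' @ [N]" "subseq s' p" for s'
    proof -
      from that(1) have "s' = [x, z]" "y = N"
        by (auto simp: Cons_eq_append_conv)
      then show False
        using subseq_set[OF that(2)] assms(2) xyz by auto
    qed
  qed (use xyz assms in auto)
qed

lemma order_isomorphic_shift: "order_isomorphic (map ((+) c) s) s"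
  by (rule order_isomorphic_map) simp

lemma avoids_shift_iff: "avoids (map ((+) c) \<rho>) \<tau> \<longleftrightarrow> avoids \<rho> \<tau>"
  unfolding avoids_iff subseq_map_iff
  using order_isomorphic_shift order_isomorphic_sym order_isomorphic_trans by blast

section \<open>Decomposition of a 132-avoider at its maximum\<close>

definition Av :: "nat \<Rightarrow> nat list set"
  where "Av n = {\<rho> \<in> perms n. avoids \<rho> [1, 3, 2]}"

definition join :: "nat list \<Rightarrow> nat list \<Rightarrow> nat list"
  where "join a b = map ((+) (length b)) a @ Suc (length a + length b) # b"

lemma permutations_of_set_iff: "xs \<in> permutations_of_set A \<longleftrightarrow> set xs = A \<and> distinct xs"
  by (simp add: permutations_of_set_def)

lemma length_perms: "\<rho> \<in> perms n \<Longrightarrow> length \<rho> = n"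
  by (auto simp: permutations_of_set_iff dest: distinct_card)

lemma AvD:
  assumes "\<rho> \<in> Av n"
  shows "\<rho> \<in> perms n" "length \<rho> = n" "set \<rho> = {1..n}" "distinct \<rho>" "avoids \<rho> [1, 3, 2]"
  using assms length_perms by (auto simp: Av_def permutations_of_set_iff)

lemma finite_Av: "finite (Av n)"
  by (simp add: Av_def)

lemma Av_0: "Av 0 = {[]}"
  by (auto simp: Av_def avoids_iff order_isomorphic_def)

lemma join_order:
  assumes "a \<in> perms i" "b \<in> perms j"
  shows "\<forall>x\<in>set (map ((+) (length b)) a) \<union> {Suc (length a + length b)}. \<forall>y\<in>set b. y < x"
    and "\<forall>x\<in>set (map ((+) (length b)) a). x < Suc (length a + length b)"
  using assms length_perms[OF assms(1)] length_perms[OF assms(2)] by (auto simp: permutations_of_set_iff)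

lemma join_in_Av:
  assumes "a \<in> Av i" "b \<in> Av j"
  shows "join a b \<in> Av (Suc (i + j))"
proof -
  note a = AvD[OF assms(1)] and b = AvD[OF assms(2)]
  have "set (map ((+) j) a) = {Suc j..i + j}"
    using a(3) image_add_atLeastAtMost[of j 1 i] by (simp add: add.commute)
  then have "set (join a b) = {1..Suc (i + j)}"
    using a b by (auto simp: join_def)
  moreover have "distinct (join a b)"
    using a b by (auto simp: join_def distinct_map)
  moreover have "avoids (join a b) [1, 3, 2]"
    unfolding join_def using join_order[OF a(1) b(1)] a(5) b(5)
    by (intro avoids_132_append_Cons) (simp_all add: avoids_shift_iff)
  ultimately show ?thesis by (simp add: Av_def permutations_of_set_iff)
qed

text \<open>An element of \<open>P\<close> below \<open>Max Q\<close> would contradict the second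
  assumption, so \<open>Q\<close> is an initial segment.\<close>

lemma lower_part_eq:
  fixes P Q :: "nat set"
  assumes "P \<union> Q = {1..n}" "\<forall>x\<in>P. \<forall>y\<in>Q. y < x"
  shows "Q = {1..card Q}"
proof (cases "Q = {}")
  case False
  have fin: "finite Q" using assms(1) by (metis finite_Un finite_atLeastAtMost)
  have "Q = {1..Max Q}"
  proof
    show "Q \<subseteq> {1..Max Q}" using assms(1) fin by auto
    show "{1..Max Q} \<subseteq> Q"
    proof
      fix x assume x: "x \<in> {1..Max Q}"
      have M: "Max Q \<in> Q" using fin False by simp
      then have "x \<in> P \<union> Q" using x assms(1) by (metis UnI2 atLeastAtMost_iff order_trans)
      then show "x \<in> Q" using assms(2) M x by (metis UnE atLeastAtMost_iff leD)
    qed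
  qed
  then show ?thesis by (metis card_atLeastAtMost diff_Suc_1)
qed simp

text \<open>A letter x before the maximum and a larger letter y after it would form a 132 with the
  maximum between them. So the part before the maximum lies entirely above the part after it, and
  lowering it by the length of the latter gives a permutation again.\<close>

lemma Av_Suc_cases:
  assumes "\<rho> \<in> Av (Suc n)"
  obtains i a b where "i \<le> n" "a \<in> Av i" "b \<in> Av (n - i)" "\<rho> = join a b"
proof -
  note \<rho> = AvD[OF assms]
  have "Suc n \<in> set \<rho>" using \<rho>(3) by simp
  then obtain p q where pq: "\<rho> = p @ Suc n # q" by (meson split_list)
  have "set \<rho> = insert (Suc n) (set p \<union> set q)" "Suc n \<notin> set p \<union> set q"
    using \<rho>(4) by (simp_all add: pq)
  then have "set p \<union> set q = set \<rho> - {Suc n}" by (metis Diff_insert_absorb)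
  also have "\<dots> = {1..n}" unfolding \<rho>(3) by auto
  finally have un: "set p \<union> set q = {1..n}" .
  have gt: "\<forall>x\<in>set p. \<forall>y\<in>set q. y < x"
  proof (intro ballI, rule ccontr)
    fix x y assume xy: "x \<in> set p" "y \<in> set q" "\<not> y < x"
    have "x \<noteq> y" using \<rho>(4) xy(1,2) unfolding pq by auto
    then have "x < y" using xy(3) by simp
    have "y \<in> {1..n}" using un xy(2) by blast
    then have "y < Suc n" by simp
    have "subseq ([x] @ Suc n # [y]) (p @ Suc n # q)"
    proof (rule list_emb_append_mono)
      show "subseq [x] p" unfolding subseq_singleton_left by (rule xy(1))
      have "subseq [y] q" unfolding subseq_singleton_left by (rule xy(2))
      then show "subseq (Suc n # [y]) (Suc n # q)" by (rule subseq_Cons2)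
    qed
    then have "subseq [x, Suc n, y] \<rho>" by (simp add: pq)
    with \<open>x < y\<close> \<open>y < Suc n\<close> \<rho>(5) show False unfolding avoids_132_iff by blast
  qed
  define j where "j = length q"
  have dist: "distinct p" "distinct q" "set p \<inter> set q = {}" using \<rho>(4) unfolding pq by auto
  have q: "set q = {1..j}"
    using lower_part_eq[OF un gt] distinct_card[OF dist(2)] by (simp add: j_def)
  have "set p = (set p \<union> set q) - set q" using dist(3) by blast
  also have "\<dots> = {Suc j..n}" unfolding un unfolding q by auto
  finally have p: "set p = {Suc j..n}" .
  have len: "length p + j = n" using \<rho>(2) pq by (simp add: j_def)
  define a where "a = map (\<lambda>x. x - j) p"
  have pa: "p = map ((+) j) a"
    unfolding a_def map_map by (rule map_idI[symmetric]) (simp add: p)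
  have "x \<in> set a \<longleftrightarrow> x \<in> {1..n - j}" for x
  proof -
    have "x \<in> set a \<longleftrightarrow> j + x \<in> set p"
      unfolding pa set_map by (simp add: inj_image_mem_iff)
    also have "\<dots> \<longleftrightarrow> x \<in> {1..n - j}" unfolding p using len by auto
    finally show ?thesis .
  qed
  then have "set a = {1..n - j}" by blast
  moreover have "distinct a" using dist(1) unfolding pa by (simp add: distinct_map)
  moreover have "avoids p [1, 3, 2]"
    by (rule avoids_subseq[OF \<rho>(5)]) (simp add: pq subseq_rev_drop_many prefix_imp_subseq)
  then have "avoids a [1, 3, 2]" unfolding pa avoids_shift_iff .
  ultimately have "a \<in> Av (n - j)" by (simp add: Av_def permutations_of_set_iff)
  moreover have "avoids q [1, 3, 2]"
    by (rule avoids_subseq[OF \<rho>(5)]) (simp add: pq list_emb_append2 list_emb_Cons)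
  then have "q \<in> Av (n - (n - j))"
    using len q dist(2) by (simp add: Av_def permutations_of_set_iff)
  moreover have "length a + j = n" using len by (simp add: a_def)
  then have "\<rho> = join a q"
    unfolding join_def pq pa j_def[symmetric] by simp
  ultimately show thesis using that[of "n - j" a q] by simp
qed

text \<open>The maximum occurs in neither side, so it marks the cut; the length of the right side
  then gives the shift to undo.\<close>

lemma join_inject:
  assumes "join a b = join a' b'" "a \<in> Av i" "b \<in> Av j" "a' \<in> Av i'" "b' \<in> Av j'"
  shows "a = a' \<and> b = b'"
proof -
  have len: "length a + length b = length a' + length b'"
    using arg_cong[OF assms(1), of length] by (simp add: join_def)
  have "Suc (length a + length b) \<notin> set (map ((+) (length b)) a)" "Suc (length a + length b) \<notin> set b"
    using AvD(2,3)[OF assms(2)] AvD(2,3)[OF assms(3)] by auto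
  with assms(1) have "map ((+) (length b)) a = map ((+) (length b')) a' \<and> b = b'"
    unfolding join_def len by (subst (asm) append_Cons_eq_iff) auto
  then show ?thesis by (auto simp: inj_map_eq_map)
qed

lemma sum_Av_Suc:
  "(\<Sum>\<rho>\<in>Av (Suc n). f \<rho>) = (\<Sum>i=0..n. \<Sum>a\<in>Av i. \<Sum>b\<in>Av (n - i). f (join a b))"
proof -
  let ?S = "SIGMA i:{0..n}. Av i \<times> Av (n - i)"
  have bij: "bij_betw (\<lambda>(i, a, b). join a b) ?S (Av (Suc n))"
    unfolding bij_betw_def
  proof
    show "inj_on (\<lambda>(i, a, b). join a b) ?S"
      by (rule inj_onI) (auto dest: join_inject AvD(2))
    show "(\<lambda>(i, a, b). join a b) ` ?S = Av (Suc n)"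
    proof
      show "(\<lambda>(i, a, b). join a b) ` ?S \<subseteq> Av (Suc n)"
      proof (clarsimp)
        fix i a b assume "i \<le> n" "a \<in> Av i" "b \<in> Av (n - i)"
        then show "join a b \<in> Av (Suc n)" using join_in_Av[of a i b "n - i"] by simp
      qed
      show "Av (Suc n) \<subseteq> (\<lambda>(i, a, b). join a b) ` ?S"
      proof
        fix \<rho> assume "\<rho> \<in> Av (Suc n)"
        then obtain i a b where "i \<le> n" "a \<in> Av i" "b \<in> Av (n - i)" "\<rho> = join a b"
          by (rule Av_Suc_cases)
        then show "\<rho> \<in> (\<lambda>(i, a, b). join a b) ` ?S"
          by (intro image_eqI[of _ _ "(i, a, b)"]) auto
      qed
    qed
  qed
  have "(\<Sum>\<rho>\<in>Av (Suc n). f \<rho>) = (\<Sum>(i, a, b)\<in>?S. f (join a b))"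
    by (subst sum.reindex_bij_betw[OF bij, symmetric]) (simp add: case_prod_unfold)
  also have "\<dots> = (\<Sum>i=0..n. \<Sum>(a, b)\<in>Av i \<times> Av (n - i). f (join a b))"
    by (subst sum.Sigma[symmetric]) (auto simp: finite_Av)
  finally show ?thesis by (simp add: sum.cartesian_product)
qed

section \<open>Weighted generating functions over 132-avoiders\<close>

definition gf :: "(nat list \<Rightarrow> rat) \<Rightarrow> rat fps"
  where "gf f = Abs_fps (\<lambda>n. \<Sum>\<rho>\<in>Av n. f \<rho>)"

text \<open>The factor \<open>fps_X\<close> accounts for the maximum and the constant for the empty
  permutation. Two products are allowed because a single occurrence can arise in two exclusive
  ways.\<close>

lemma gf_join:
  assumes "\<And>i j a b. a \<in> Av i \<Longrightarrow> b \<in> Av j \<Longrightarrow> f (join a b) = g a * h b + g' a * h' b"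
  shows "gf f = fps_const (f []) + fps_X * (gf g * gf h + gf g' * gf h')"
proof (rule fps_ext)
  fix n
  show "gf f $ n = (fps_const (f []) + fps_X * (gf g * gf h + gf g' * gf h')) $ n"
  proof (cases n)
    case 0
    then show ?thesis by (simp add: gf_def Av_0)
  next
    case (Suc m)
    have "gf f $ n = (\<Sum>i=0..m. \<Sum>a\<in>Av i. \<Sum>b\<in>Av (m - i). g a * h b + g' a * h' b)"
      using assms by (simp add: gf_def Suc sum_Av_Suc)
    also have "\<dots> = (gf g * gf h + gf g' * gf h') $ m"
      by (simp add: gf_def fps_mult_nth sum_product sum.distrib)
    finally show ?thesis by (simp add: Suc)
  qed
qed

section \<open>Occurrences of patterns from the family\<close>

text \<open>Recognises an occurrence of any member of the family without naming the member: only
  comparisons enter, so it applies to words that are not permutations. Positions start at 0, so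
  \<open>{l..<l + m}\<close> are the last \<open>m\<close> of them.\<close>

definition is_pat :: "nat \<Rightarrow> nat \<Rightarrow> nat list \<Rightarrow> bool"
  where "is_pat l m s \<longleftrightarrow> length s = l + m \<and> (\<forall>j\<in>{l..<l + m}. \<forall>i<j. s ! i < s ! j)"

definition pats :: "nat \<Rightarrow> nat \<Rightarrow> nat list \<Rightarrow> nat list set"
  where "pats l m \<rho> = {s. subseq s \<rho> \<and> is_pat l m s}"

lemma is_pat_0: "is_pat l 0 s \<longleftrightarrow> length s = l"
  by (auto simp: is_pat_def)

lemma is_pat_snoc: "is_pat l (Suc m) (s @ [x]) \<longleftrightarrow> is_pat l m s \<and> (\<forall>y\<in>set s. y < x)"
proof (cases "length s = l + m")
  case True
  have "{l..<l + Suc m} = insert (l + m) {l..<l + m}" by auto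
  then show ?thesis
    using True by (auto simp: is_pat_def nth_append all_set_conv_all_nth)
next
  case False
  then show ?thesis by (simp add: is_pat_def)
qed

lemma is_pat_SucE:
  assumes "is_pat l (Suc m) s"
  obtains t x where "s = t @ [x]" "is_pat l m t" "\<forall>y\<in>set t. y < x"
proof (cases s rule: rev_cases)
  case Nil
  with assms show thesis by (simp add: is_pat_def)
next
  case (snoc t x)
  with assms that show thesis by (simp add: is_pat_snoc)
qed

lemma is_pat_order_isomorphic:
  assumes "order_isomorphic s t" "is_pat l m t"
  shows "is_pat l m s"
  using assms by (simp add: is_pat_def order_isomorphic_def)

lemma snoc_max_perms:
  assumes "t @ [x] \<in> perms (Suc n)" "\<forall>y\<in>set t. y < x"
  shows "x = Suc n"
proof -
  have "Suc n \<in> insert x (set t)" "x \<le> Suc n"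
    using assms(1) by (auto simp: permutations_of_set_iff)
  with assms(2) show ?thesis by auto
qed

lemma snoc_perms_iff: "t @ [Suc n] \<in> perms (Suc n) \<longleftrightarrow> t \<in> perms n"
proof -
  have "{1..Suc n} = insert (Suc n) {1..n}" "Suc n \<notin> {1..n}" by auto
  then show ?thesis
    unfolding permutations_of_set_iff by (auto simp: insert_ident)
qed

text \<open>In a permutation, a last letter above all others must be the top value; peeling it off
  repeatedly turns the dominance condition into the prescribed tail.\<close>

lemma pattern_set_iff: "\<sigma> \<in> pattern_set l (l + m) \<longleftrightarrow> \<sigma> \<in> perms (l + m) \<and> is_pat l m \<sigma>"
proof (induction m arbitrary: \<sigma>)
  case 0
  show ?case using length_perms[of \<sigma> l] by (auto simp: pattern_set_def is_pat_0)
next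
  case (Suc m)
  show ?case
  proof (cases \<sigma> rule: rev_cases)
    case Nil
    then show ?thesis using length_perms[of \<sigma> "l + Suc m"] by (auto simp: pattern_set_def)
  next
    case (snoc t x)
    have "\<sigma> \<in> pattern_set l (l + Suc m) \<longleftrightarrow> x = Suc (l + m) \<and> t \<in> pattern_set l (l + m)"
    proof (cases "length t = l + m")
      case True
      then show ?thesis
        using snoc_perms_iff[of t "l + m"] by (auto simp: pattern_set_def snoc)
    next
      case False
      then show ?thesis
        using length_perms[of \<sigma> "l + Suc m"] length_perms[of t "l + m"]
        by (auto simp: pattern_set_def snoc)
    qed
    also have "\<dots> \<longleftrightarrow> x = Suc (l + m) \<and> t \<in> perms (l + m) \<and> is_pat l m t"
      by (simp add: Suc.IH)
    also have "\<dots> \<longleftrightarrow> \<sigma> \<in> perms (l + Suc m) \<and> is_pat l (Suc m) \<sigma>"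
    proof
      assume "x = Suc (l + m) \<and> t \<in> perms (l + m) \<and> is_pat l m t"
      then show "\<sigma> \<in> perms (l + Suc m) \<and> is_pat l (Suc m) \<sigma>"
        using snoc_perms_iff[of t "l + m"] permutations_of_setD(1)[of t "{1..l + m}"]
        by (simp add: snoc is_pat_snoc)
    next
      assume *: "\<sigma> \<in> perms (l + Suc m) \<and> is_pat l (Suc m) \<sigma>"
      then have "x = Suc (l + m)"
        using snoc_max_perms[of t x "l + m"] by (simp add: snoc is_pat_snoc)
      with * show "x = Suc (l + m) \<and> t \<in> perms (l + m) \<and> is_pat l m t"
        using snoc_perms_iff[of t "l + m"] by (simp add: snoc is_pat_snoc)
    qed
    finally show ?thesis .
  qed
qed

text \<open>The family member witnessing a subsequence is its standardisation, which inherits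
  \<open>is_pat\<close>.\<close>

lemma pats_eq:
  assumes "distinct \<rho>"
  shows "pats l m \<rho> = {s. subseq s \<rho> \<and> (\<exists>\<sigma>\<in>pattern_set l (l + m). order_isomorphic s \<sigma>)}"
proof -
  have "is_pat l m s \<longleftrightarrow> (\<exists>\<sigma>\<in>pattern_set l (l + m). order_isomorphic s \<sigma>)" if "subseq s \<rho>" for s
  proof
    assume s: "is_pat l m s"
    have "standardize s \<in> perms (length s)"
      using subseq_distinct[OF that assms] by (rule standardize_in_perms)
    moreover have "is_pat l m (standardize s)"
      using order_isomorphic_standardize s by (rule is_pat_order_isomorphic)
    ultimately have "standardize s \<in> pattern_set l (l + m)"
      using s unfolding pattern_set_iff by (simp add: is_pat_def)
    then show "\<exists>\<sigma>\<in>pattern_set l (l + m). order_isomorphic s \<sigma>"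
      using order_isomorphic_sym[OF order_isomorphic_standardize] by blast
  next
    assume "\<exists>\<sigma>\<in>pattern_set l (l + m). order_isomorphic s \<sigma>"
    then show "is_pat l m s"
      using is_pat_order_isomorphic pattern_set_iff by blast
  qed
  then show ?thesis unfolding pats_def by blast
qed

definition only_pat :: "nat \<Rightarrow> nat \<Rightarrow> nat list \<Rightarrow> nat list \<Rightarrow> bool"
  where "only_pat l m \<tau> \<rho> \<longleftrightarrow> (\<exists>s. pats l m \<rho> = {s} \<and> order_isomorphic s \<tau>)"

text \<open>Avoiding the other members leaves only occurrences of \<tau> among the family's
  subsequences. Conversely, if a single such subsequence exists and has type \<tau>, an occurrence
  of another member would be that same subsequence and force the two patterns to coincide.\<close>

lemma only_pat_iff:
  assumes "distinct \<rho>" "\<tau> \<in> pattern_set l (l + m)"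
  shows "(\<forall>\<sigma>\<in>pattern_set l (l + m) - {\<tau>}. avoids \<rho> \<sigma>) \<and> card (occurrences \<tau> \<rho>) = 1
    \<longleftrightarrow> only_pat l m \<tau> \<rho>"
  unfolding card_occurrences_eq_1_iff[OF assms(1)]
proof
  assume *: "(\<forall>\<sigma>\<in>pattern_set l (l + m) - {\<tau>}. avoids \<rho> \<sigma>) \<and>
    (\<exists>s. {s. subseq s \<rho> \<and> order_isomorphic s \<tau>} = {s})"
  then obtain s where s: "{s. subseq s \<rho> \<and> order_isomorphic s \<tau>} = {s}" by blast
  have "order_isomorphic t \<tau>"
    if "subseq t \<rho>" "\<sigma> \<in> pattern_set l (l + m)" "order_isomorphic t \<sigma>" for t \<sigma>
    using that * unfolding avoids_iff by blast
  then have "pats l m \<rho> = {s. subseq s \<rho> \<and> order_isomorphic s \<tau>}"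
    unfolding pats_eq[OF assms(1)] using assms(2) by blast
  then show "only_pat l m \<tau> \<rho>"
    unfolding only_pat_def using s by blast
next
  assume "only_pat l m \<tau> \<rho>"
  then obtain s where s: "pats l m \<rho> = {s}" "order_isomorphic s \<tau>"
    unfolding only_pat_def by blast
  have eq: "t = s" if "subseq t \<rho>" "\<sigma> \<in> pattern_set l (l + m)" "order_isomorphic t \<sigma>" for t \<sigma>
  proof -
    have "t \<in> pats l m \<rho>" using that unfolding pats_eq[OF assms(1)] by blast
    with s(1) show ?thesis by simp
  qed
  have sub: "subseq s \<rho>" using s(1) unfolding pats_def by blast
  have "avoids \<rho> \<sigma>" if \<sigma>: "\<sigma> \<in> pattern_set l (l + m)" "\<sigma> \<noteq> \<tau>" for \<sigma>
    unfolding avoids_iff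
  proof (intro allI impI notI)
    fix t assume "subseq t \<rho>" "order_isomorphic t \<sigma>"
    with eq \<sigma>(1) have "order_isomorphic s \<sigma>" by blast
    then have "order_isomorphic \<sigma> \<tau>"
      using s(2) order_isomorphic_sym order_isomorphic_trans by blast
    then have "\<sigma> = \<tau>"
      using \<sigma>(1) assms(2) unfolding pattern_set_def by (blast intro: order_isomorphic_perms_eq)
    with \<sigma>(2) show False by simp
  qed
  moreover have "{t. subseq t \<rho> \<and> order_isomorphic t \<tau>} = {s}"
    using eq[OF _ assms(2)] sub s(2) by blast
  ultimately show "(\<forall>\<sigma>\<in>pattern_set l (l + m) - {\<tau>}. avoids \<rho> \<sigma>) \<and>
    (\<exists>s. {s. subseq s \<rho> \<and> order_isomorphic s \<tau>} = {s})" by blast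
qed

lemma pats_shift: "pats l m (map ((+) c) \<rho>) = map ((+) c) ` pats l m \<rho>"
proof -
  have "is_pat l m (map ((+) c) s) \<longleftrightarrow> is_pat l m s" for s
    using is_pat_order_isomorphic order_isomorphic_shift order_isomorphic_sym by blast
  then show ?thesis
    unfolding pats_def subseq_map_iff by auto
qed

text \<open>A subsequence ending in its largest letter cannot cross into \<open>q\<close>. If it
  uses \<open>N\<close>, then \<open>N\<close> is its last letter, and deleting it shortens the
  dominating tail by one.\<close>

lemma pats_append_Cons:
  assumes "\<forall>x\<in>set p \<union> {N}. \<forall>y\<in>set q. y < x" "\<forall>x\<in>set p. x < N"
  shows "pats l (Suc m) (p @ N # q) =
    pats l (Suc m) p \<union> (\<lambda>s. s @ [N]) ` pats l m p \<union> pats l (Suc m) q"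
proof (intro equalityI subsetI)
  fix s assume "s \<in> pats l (Suc m) (p @ N # q)"
  then have s: "subseq s (p @ N # q)" "is_pat l (Suc m) s" by (simp_all add: pats_def)
  from s(2) obtain t x where t: "s = t @ [x]" "is_pat l m t" "\<forall>y\<in>set t. y < x"
    by (rule is_pat_SucE)
  then have "s \<noteq> []" "hd s \<le> last s" by (cases t; force)+
  with s(1) show "s \<in> pats l (Suc m) p \<union> (\<lambda>s. s @ [N]) ` pats l m p \<union> pats l (Suc m) q"
    by (rule subseq_hd_le_last_cases) (use assms(1) s(2) t(1,2) in \<open>simp_all add: pats_def\<close>)
next
  fix s assume "s \<in> pats l (Suc m) p \<union> (\<lambda>s. s @ [N]) ` pats l m p \<union> pats l (Suc m) q"
  then consider "s \<in> pats l (Suc m) p" | t where "s = t @ [N]" "t \<in> pats l m p" | "s \<in> pats l (Suc m) q"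
    by blast
  then show "s \<in> pats l (Suc m) (p @ N # q)"
  proof cases
    case 1
    then show ?thesis by (simp add: pats_def subseq_rev_drop_many)
  next
    case 2
    then have "subseq (t @ [N]) (p @ N # q)"
      by (intro list_emb_append_mono) (simp_all add: pats_def)
    moreover have "\<forall>y\<in>set t. y < N"
      using 2(2) assms(2) subseq_set[of t p] by (auto simp: pats_def)
    ultimately show ?thesis using 2 by (simp add: pats_def is_pat_snoc)
  next
    case 3
    then show ?thesis by (simp add: pats_def list_emb_append2 list_emb_Cons)
  qed
qed

lemma pats_SucE:
  assumes "s \<in> pats l (Suc m) \<rho>"
  obtains t x where "s = t @ [x]" "t \<in> pats l m \<rho>" "\<forall>y\<in>set t. y < x"
proof -
  from assms have s: "subseq s \<rho>" "is_pat l (Suc m) s" by (simp_all add: pats_def)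
  from s(2) obtain t x where t: "s = t @ [x]" "is_pat l m t" "\<forall>y\<in>set t. y < x"
    by (rule is_pat_SucE)
  have "subseq t s" unfolding t(1) by (rule subseq_rev_drop_many) simp
  then have "subseq t \<rho>" using s(1) by (rule subseq_order.order_trans)
  with t that show thesis by (simp add: pats_def)
qed

lemma pats_Suc_empty: "pats l m \<rho> = {} \<Longrightarrow> pats l (Suc m) \<rho> = {}"
  by (blast elim: pats_SucE)

text \<open>In a longer occurrence one may drop either of the last two entries.\<close>

lemma pats_Suc_empty_of_singleton:
  assumes "l \<ge> 1" "pats l m \<rho> = {s}"
  shows "pats l (Suc m) \<rho> = {}"
proof (rule ccontr)
  assume "pats l (Suc m) \<rho> \<noteq> {}"
  then obtain u where u: "u \<in> pats l (Suc m) \<rho>" by blast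
  then obtain t x where t: "u = t @ [x]" "t \<in> pats l m \<rho>" "\<forall>y\<in>set t. y < x"
    by (rule pats_SucE)
  from t(2) have pt: "is_pat l m t" by (simp add: pats_def)
  with assms(1) have "t \<noteq> []" by (auto simp: is_pat_def)
  then obtain v y where v: "t = v @ [y]" by (metis rev_exhaust)
  have "is_pat l m (v @ [x])"
  proof (cases m)
    case 0
    then show ?thesis using pt by (simp add: is_pat_0 v)
  next
    case (Suc m')
    then show ?thesis using pt t(3) by (simp add: is_pat_snoc v)
  qed
  moreover have "subseq (v @ [x]) u"
    unfolding t(1) v by (intro list_emb_append_mono subseq_rev_drop_many) simp_all
  then have "subseq (v @ [x]) \<rho>"
    using u subseq_order.order_trans by (auto simp: pats_def)
  ultimately have "v @ [x] \<in> pats l m \<rho>" by (simp add: pats_def)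
  with t(2) assms(2) have "v @ [x] = v @ [y]" by (simp add: v)
  with t(3) show False by (simp add: v)
qed

lemma pats_join:
  assumes "a \<in> Av i" "b \<in> Av j"
  shows "pats l (Suc m) (join a b) =
    map ((+) (length b)) ` pats l (Suc m) a
    \<union> (\<lambda>s. map ((+) (length b)) s @ [Suc (length a + length b)]) ` pats l m a
    \<union> pats l (Suc m) b"
  unfolding join_def pats_append_Cons[OF join_order[OF AvD(1)[OF assms(1)] AvD(1)[OF assms(2)]]]
  by (simp add: pats_shift image_image)

text \<open>An occurrence with the longer tail inside \<open>a\<close> contains one with the shorter
  tail, so excluding the latter also excludes the former.\<close>

lemma pats_join_empty_iff:
  assumes "a \<in> Av i" "b \<in> Av j"
  shows "pats l (Suc m) (join a b) = {} \<longleftrightarrow> pats l m a = {} \<and> pats l (Suc m) b = {}"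
  unfolding pats_join[OF assms] using pats_Suc_empty[of l m a] by auto

text \<open>If \<open>a\<close> has no shorter occurrence, everything happens in \<open>b\<close>.
  Otherwise each shorter occurrence in \<open>a\<close> extends by the maximum to a different
  occurrence, so there is exactly one and \<open>b\<close> contributes none; by
  \<open>pats_Suc_empty_of_singleton\<close>, uniqueness in \<open>a\<close> also rules out a longer
  occurrence inside \<open>a\<close>.\<close>

lemma only_pat_join_iff:
  assumes "a \<in> Av i" "b \<in> Av j" "l \<ge> 1" "\<forall>y\<in>set \<tau>. y < k"
  shows "only_pat l (Suc m) (\<tau> @ [k]) (join a b) \<longleftrightarrow>
    pats l m a = {} \<and> only_pat l (Suc m) (\<tau> @ [k]) b \<or>
    only_pat l m \<tau> a \<and> pats l (Suc m) b = {}"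
proof (cases "pats l m a = {}")
  case True
  then have "pats l (Suc m) (join a b) = pats l (Suc m) b"
    using pats_Suc_empty[OF True] by (simp add: pats_join[OF assms(1,2)])
  with True show ?thesis by (simp add: only_pat_def)
next
  case False
  define N where "N = Suc (length a + length b)"
  define f where "f s = map ((+) (length b)) s @ [N]" for s
  have J: "pats l (Suc m) (join a b) =
      map ((+) (length b)) ` pats l (Suc m) a \<union> f ` pats l m a \<union> pats l (Suc m) b"
    unfolding pats_join[OF assms(1,2)] f_def N_def ..
  have top: "N \<notin> set s" if "s \<in> pats l (Suc m) b" for s
    using that subseq_set[of s b] AvD(2,3)[OF assms(2)] by (auto simp: pats_def N_def)
  have iso: "order_isomorphic (f s) (\<tau> @ [k]) \<longleftrightarrow> order_isomorphic s \<tau>" if "s \<in> pats l m a" for s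
  proof -
    have "subseq s a" using that by (simp add: pats_def)
    then have "\<forall>y\<in>set (map ((+) (length b)) s). y < N"
      using subseq_set[of s a] AvD(2,3)[OF assms(1)] by (auto simp: N_def)
    then have "order_isomorphic (f s) (\<tau> @ [k]) \<longleftrightarrow> order_isomorphic (map ((+) (length b)) s) \<tau>"
      unfolding f_def using assms(4) by (rule order_isomorphic_snoc)
    also have "\<dots> \<longleftrightarrow> order_isomorphic s \<tau>"
      using order_isomorphic_shift order_isomorphic_sym order_isomorphic_trans by blast
    finally show ?thesis .
  qed
  have inj: "f s = f t \<longleftrightarrow> s = t" for s t
    by (auto simp: f_def inj_map_eq_map)
  show ?thesis
  proof
    assume "only_pat l (Suc m) (\<tau> @ [k]) (join a b)"
    then obtain u where u: "pats l (Suc m) (join a b) = {u}" "order_isomorphic u (\<tau> @ [k])"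
      unfolding only_pat_def by blast
    from False obtain s where s: "s \<in> pats l m a" by blast
    then have "f s \<in> {u}" unfolding u(1)[symmetric] J by blast
    then have us: "u = f s" by simp
    have "t = s" if "t \<in> pats l m a" for t
    proof -
      have "f t \<in> {u}" using that unfolding u(1)[symmetric] J by blast
      then show ?thesis by (simp add: us inj)
    qed
    with s have "pats l m a = {s}" by blast
    moreover have "order_isomorphic s \<tau>" using u(2) iso[OF s] by (simp add: us)
    moreover have "pats l (Suc m) b = {}"
    proof (rule ccontr)
      assume "pats l (Suc m) b \<noteq> {}"
      then obtain t where t: "t \<in> pats l (Suc m) b" by blast
      then have "t \<in> {u}" unfolding u(1)[symmetric] J by blast
      \<comment> \<open>The single occurrence already ends in the maximum, which is not a letter of
        \<open>b\<close>.\<close>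
      then have "N \<in> set t" by (simp add: us f_def)
      with top[OF t] show False by simp
    qed
    ultimately show "pats l m a = {} \<and> only_pat l (Suc m) (\<tau> @ [k]) b \<or>
      only_pat l m \<tau> a \<and> pats l (Suc m) b = {}"
      unfolding only_pat_def by blast
  next
    assume "pats l m a = {} \<and> only_pat l (Suc m) (\<tau> @ [k]) b \<or>
      only_pat l m \<tau> a \<and> pats l (Suc m) b = {}"
    with False obtain s where s: "pats l m a = {s}" "order_isomorphic s \<tau>" "pats l (Suc m) b = {}"
      unfolding only_pat_def by blast
    have "pats l (Suc m) (join a b) = {f s}"
      unfolding J s(1,3) pats_Suc_empty_of_singleton[OF assms(3) s(1)] by simp
    moreover have "order_isomorphic (f s) (\<tau> @ [k])" using iso[of s] s by simp
    ultimately show "only_pat l (Suc m) (\<tau> @ [k]) (join a b)"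
      unfolding only_pat_def by blast
  qed
qed

section \<open>Generating functions\<close>

lemma Suc_times_central_binomial:
  "Suc n * ((2 * Suc n) choose Suc n) = 2 * (2 * n + 1) * ((2 * n) choose n)"
proof -
  have 1: "Suc n * ((2 * Suc n) choose Suc n) = 2 * (Suc n * (Suc (2 * n) choose n))"
    using Suc_times_binomial[of n "Suc (2 * n)"] by simp
  have "Suc n * (Suc (2 * n) choose n) = (2 * n + 1) * ((2 * n) choose n)"
    using binomial_absorb_comp[of "Suc (2 * n)" n] by simp
  with 1 show ?thesis by simp
qed

lemma catalan_Suc: "of_nat (n + 2) * catalan (Suc n) = of_nat (4 * n + 2) * catalan n"
proof -
  have "of_nat (Suc n * ((2 * Suc n) choose Suc n)) = (of_nat (2 * (2 * n + 1) * ((2 * n) choose n)) :: rat)"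
    by (simp only: Suc_times_central_binomial)
  then have *: "of_nat (n + 1) * of_nat ((2 * Suc n) choose Suc n) =
      (of_nat (4 * n + 2) * of_nat ((2 * n) choose n) :: rat)"
    by (simp only: of_nat_mult[symmetric]) (simp add: algebra_simps)
  have "of_nat (n + 2) * catalan (Suc n) = of_nat ((2 * Suc n) choose Suc n)"
    unfolding catalan_def by (simp add: field_simps del: binomial_Suc_Suc of_nat_Suc mult_Suc_right of_nat_add)
  moreover have "of_nat (n + 1) * catalan n = of_nat ((2 * n) choose n)"
    unfolding catalan_def by (simp del: of_nat_Suc of_nat_add)
  ultimately have "of_nat (n + 1) * (of_nat (n + 2) * catalan (Suc n)) = of_nat (n + 1) * (of_nat (4 * n + 2) * catalan n)"
    using * by (metis mult.left_commute)
  then show ?thesis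
    by (simp only: mult_cancel_left of_nat_eq_0_iff) simp
qed

text \<open>
  The recurrence for the coefficients says that \<open>S = 1 - 2xC\<close> satisfies \<open>(1 - 4x) S' = -2S\<close>;
  comparing the equation for \<open>S\<^sup>2\<close> with that for \<open>1 - 4x\<close> gives \<open>S\<^sup>2 = 1 - 4x\<close>.
\<close>

lemma catalan_fps_eq: "Abs_fps catalan = 1 + fps_X * (Abs_fps catalan)\<^sup>2"
proof -
  define K S Y where "K = Abs_fps catalan" and "S = 1 - 2 * (fps_X * K)" and "Y = S\<^sup>2"
  have S0: "S $ 0 = 1" and SSuc: "S $ Suc n = - 2 * catalan n" for n
    by (simp_all add: S_def K_def numeral_fps_const)
  have "(1 - 4 * fps_X) * fps_deriv S = - 2 * S"
  proof (rule fps_ext)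
    fix n
    have "of_nat (Suc n) * S $ Suc n = of_nat (4 * n) * S $ n - 2 * S $ n"
    proof (cases n)
      case 0
      then show ?thesis by (simp add: S0 SSuc catalan_def)
    next
      case (Suc k)
      then show ?thesis using catalan_Suc[of k] by (simp add: SSuc algebra_simps)
    qed
    then show "((1 - 4 * fps_X) * fps_deriv S) $ n = (- 2 * S) $ n"
      by (cases n) (simp_all add: left_diff_distrib mult.assoc numeral_fps_const)
  qed
  then have "(1 - 4 * fps_X) * fps_deriv Y = - 4 * Y"
    unfolding Y_def power2_eq_square fps_deriv_mult by algebra
  then have coeff: "((1 - 4 * fps_X) * fps_deriv Y) $ n = (- 4 * Y) $ n" for n by simp
  have Y0: "Y $ 0 = 1" by (simp add: Y_def S0 fps_mult_nth power2_eq_square)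
  have YSuc: "of_nat (Suc n) * Y $ Suc n = (4 * of_nat n - 4) * Y $ n" for n
    using coeff[of n] by (cases n) (simp_all add: left_diff_distrib mult.assoc numeral_fps_const algebra_simps)
  have Y1: "Y $ 1 = - 4" using YSuc[of 0] Y0 by simp
  \<comment> \<open>The factor \<open>4 * of_nat n - 4\<close> vanishes at index 1, so the
    recurrence kills every coefficient from index 2 on.\<close>
  have Y2: "Y $ Suc (Suc n) = 0" for n
  proof (induction n)
    case 0
    show ?case using YSuc[of 1] by simp
  next
    case (Suc n)
    then show ?case using YSuc[of "Suc (Suc n)"] by simp
  qed
  have "Y = 1 - 4 * fps_X"
  proof (rule fps_ext)
    fix n
    consider "n = 0" | "n = 1" | i where "n = Suc (Suc i)"
      by (metis One_nat_def not0_implies_Suc)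
    then show "Y $ n = (1 - 4 * fps_X) $ n"
      by cases (use Y0 Y1 Y2 in \<open>simp_all add: numeral_fps_const\<close>)
  qed
  then have "4 * fps_X * (K - (1 + fps_X * K\<^sup>2)) = 0"
    unfolding Y_def S_def by algebra
  then show ?thesis by (simp add: K_def)
qed

text \<open>The difference of two solutions is annihilated by a series with constant term 1, which
  is nonzero in an integral domain.\<close>

lemma catalan_fps_unique:
  fixes C D :: "'a::idom fps"
  assumes "C = 1 + fps_X * C\<^sup>2" "D = 1 + fps_X * D\<^sup>2"
  shows "C = D"
proof -
  have "(C - D) * (1 - fps_X * (C + D)) = 0"
    using assms by algebra
  moreover have "(1 - fps_X * (C + D)) $ 0 \<noteq> 0" by simp
  then have "1 - fps_X * (C + D) \<noteq> 0" by (metis fps_zero_nth)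
  ultimately show ?thesis by simp
qed

lemma gf_zero: "gf (\<lambda>_. 0) = 0"
  by (simp add: gf_def fps_eq_iff)

text \<open>With all weights equal to 1, \<open>gf_join\<close> becomes the quadratic equation of
  the Catalan series.\<close>

lemma card_Av: "of_nat (card (Av n)) = catalan n"
proof -
  have "gf (\<lambda>_. 1) = 1 + fps_X * (gf (\<lambda>_. 1))\<^sup>2"
    using gf_join[of "\<lambda>_. 1" "\<lambda>_. 1" "\<lambda>_. 1" "\<lambda>_. 0" "\<lambda>_. 0"]
    by (simp add: gf_zero power2_eq_square)
  then have "gf (\<lambda>_. 1) = Abs_fps catalan"
    using catalan_fps_eq by (rule catalan_fps_unique)
  then have "gf (\<lambda>_. 1) $ n = catalan n" by simp
  then show ?thesis by (simp add: gf_def)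
qed

section \<open>Recurrences and initial values of the two series\<close>

definition avoid_gf :: "nat \<Rightarrow> nat \<Rightarrow> rat fps"
  where "avoid_gf l m = gf (\<lambda>\<rho>. of_bool (pats l m \<rho> = {}))"

definition only_gf :: "nat \<Rightarrow> nat \<Rightarrow> nat list \<Rightarrow> rat fps"
  where "only_gf l m \<tau> = gf (\<lambda>\<rho>. of_bool (only_pat l m \<tau> \<rho>))"

lemma pats_Suc_Nil: "pats l (Suc m) [] = {}"
  by (auto simp: pats_def is_pat_def)

lemma avoid_gf_Suc: "avoid_gf l (Suc m) = 1 + fps_X * (avoid_gf l m * avoid_gf l (Suc m))"
  unfolding avoid_gf_def
  by (subst gf_join[where g = "\<lambda>\<rho>. of_bool (pats l m \<rho> = {})" and
        h = "\<lambda>\<rho>. of_bool (pats l (Suc m) \<rho> = {})" and g' = "\<lambda>_. 0" and h' = "\<lambda>_. 0"])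
    (simp_all add: pats_join_empty_iff gf_zero pats_Suc_Nil)

lemma only_gf_Suc:
  assumes "l \<ge> 1" "\<forall>y\<in>set \<tau>. y < k"
  shows "only_gf l (Suc m) (\<tau> @ [k]) = fps_X *
    (avoid_gf l m * only_gf l (Suc m) (\<tau> @ [k]) + only_gf l m \<tau> * avoid_gf l (Suc m))"
proof -
  have "of_bool (only_pat l (Suc m) (\<tau> @ [k]) (join a b)) =
      of_bool (pats l m a = {}) * of_bool (only_pat l (Suc m) (\<tau> @ [k]) b) +
      (of_bool (only_pat l m \<tau> a) * of_bool (pats l (Suc m) b = {}) :: rat)"
    if "a \<in> Av i" "b \<in> Av j" for a b i j
    \<comment> \<open>The two alternatives exclude each other, since \<open>only_pat l m\<close>
      makes \<open>pats l m a\<close> nonempty; the indicator of the disjunction is therefore a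
      sum.\<close>
    unfolding only_pat_join_iff[OF that assms] by (auto simp: only_pat_def)
  moreover have "\<not> only_pat l (Suc m) (\<tau> @ [k]) []"
    by (simp add: only_pat_def pats_Suc_Nil)
  ultimately show ?thesis
    unfolding only_gf_def avoid_gf_def by (subst gf_join) simp_all
qed

lemma subseq_take: "subseq (take n xs) xs"
  by (rule prefix_imp_subseq) (rule take_is_prefix)

text \<open>For an empty tail every subsequence of length \<open>l\<close> counts, so avoidance
  means length below \<open>l\<close> and the Catalan series is truncated.\<close>

lemma avoid_gf_0:
  assumes "l \<ge> 1"
  shows "avoid_gf l 0 = (\<Sum>j=0..l - 1. fps_const (catalan j) * fps_X ^ j)"
proof (rule fps_ext)
  fix n
  have "pats l 0 \<rho> = {} \<longleftrightarrow> n < l" if "\<rho> \<in> Av n" for \<rho>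
  proof -
    have len: "length \<rho> = n" using that by (rule AvD)
    show ?thesis
    proof
      assume "pats l 0 \<rho> = {}"
      then have "length (take l \<rho>) \<noteq> l"
        using subseq_take[of l \<rho>] unfolding pats_def is_pat_0 by blast
      then show "n < l" by (simp add: len)
    next
      assume "n < l"
      then show "pats l 0 \<rho> = {}"
        using list_emb_length[of "(=)" _ \<rho>] by (fastforce simp: pats_def is_pat_0 len)
    qed
  qed
  then have "avoid_gf l 0 $ n = (if n < l then catalan n else 0)"
    by (simp add: avoid_gf_def gf_def card_Av)
  also have "\<dots> = (\<Sum>j=0..l - 1. fps_const (catalan j) * fps_X ^ j) $ n"
    using assms by (auto simp: fps_sum_nth fps_X_power_nth if_distrib cong: if_cong)
  finally show "avoid_gf l 0 $ n = (\<Sum>j=0..l - 1. fps_const (catalan j) * fps_X ^ j) $ n" .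
qed

lemma only_gf_0:
  assumes "l \<ge> 1" "\<tau> \<in> Av l"
  shows "only_gf l 0 \<tau> = fps_X ^ l"
proof (rule fps_ext)
  fix n
  have "only_pat l 0 \<tau> \<rho> \<longleftrightarrow> \<rho> = \<tau>" if "\<rho> \<in> Av n" for \<rho>
  proof
    assume "only_pat l 0 \<tau> \<rho>"
    then obtain s where s: "pats l 0 \<rho> = {s}" "order_isomorphic s \<tau>"
      unfolding only_pat_def by blast
    have "s \<in> pats l 0 \<rho>" using s(1) by simp
    then have "l \<le> length \<rho>"
      by (auto simp: pats_def is_pat_0 dest: list_emb_length)
    moreover have "\<not> l < length \<rho>"
    proof
      assume less: "l < length \<rho>"
      then obtain x xs where \<rho>: "\<rho> = x # xs" by (cases \<rho>) auto
      \<comment> \<open>A permutation longer than \<open>l\<close> has two different subsequences of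
        length \<open>l\<close>: the one starting at its first letter contains that letter, the one
        starting just after it does not.\<close>
      have "take l \<rho> \<in> pats l 0 \<rho>" "take l xs \<in> pats l 0 \<rho>"
        using less subseq_take[of l \<rho>] subseq_take[of l xs]
        by (simp_all add: pats_def is_pat_0 \<rho> list_emb_Cons)
      then have "take l \<rho> = take l xs" unfolding s(1) by simp
      moreover have "x \<in> set (take l \<rho>)" using assms(1) by (cases l) (simp_all add: \<rho>)
      moreover have "x \<notin> set xs" using AvD(4)[OF that] by (simp add: \<rho>)
      ultimately show False by (metis in_set_takeD)
    qed
    ultimately have "\<rho> \<in> pats l 0 \<rho>" by (simp add: pats_def is_pat_0)
    then have "order_isomorphic \<rho> \<tau>" using s by simp
    then show "\<rho> = \<tau>"
      using AvD(1)[OF that] AvD(1)[OF assms(2)] by (rule order_isomorphic_perms_eq)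
  next
    assume "\<rho> = \<tau>"
    moreover have "pats l 0 \<tau> = {\<tau>}"
      using AvD(2)[OF assms(2)] by (auto simp: pats_def is_pat_0 dest: subseq_same_length)
    ultimately show "only_pat l 0 \<tau> \<rho>" by (simp add: only_pat_def order_isomorphic_refl)
  qed
  then have "only_gf l 0 \<tau> $ n = (\<Sum>\<rho>\<in>Av n. if \<rho> = \<tau> then 1 else 0)"
    by (auto simp: only_gf_def gf_def intro!: sum.cong)
  also have "\<dots> = (if \<tau> \<in> Av n then 1 else 0)"
    by (simp add: finite_Av)
  also have "\<tau> \<in> Av n \<longleftrightarrow> n = l"
    using assms(2) AvD(2) by blast
  finally show "only_gf l 0 \<tau> $ n = fps_X ^ l $ n"
    by (simp add: fps_X_power_nth)
qed

lemma F_eq_only_gf: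
  assumes "\<tau> \<in> pattern_set l (l + m)"
  shows "F (pattern_set l (l + m) - {\<tau>}) \<tau> = only_gf l m \<tau>"
proof (rule fps_ext)
  fix n
  have "{\<rho> \<in> perms n. avoids \<rho> [1, 3, 2] \<and> (\<forall>\<sigma>\<in>pattern_set l (l + m) - {\<tau>}. avoids \<rho> \<sigma>) \<and>
      card (occurrences \<tau> \<rho>) = 1} = {\<rho> \<in> Av n. only_pat l m \<tau> \<rho>}"
    using only_pat_iff[OF _ assms] permutations_of_setD(2) unfolding Av_def by blast
  then show "F (pattern_set l (l + m) - {\<tau>}) \<tau> $ n = only_gf l m \<tau> $ n"
    by (simp add: F_def only_gf_def gf_def finite_Av sum_of_bool_eq Int_def)
qed

lemma one_minus_mult_avoid_gf: "avoid_gf l (Suc m) * (1 - fps_X * avoid_gf l m) = 1"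
  using avoid_gf_Suc[of l m] by algebra

text \<open>The recurrence is linear in the unknown series, which appears with the factor
  \<open>1 - fps_X * avoid_gf l m\<close>; multiplying by the inverse
  \<open>avoid_gf l (Suc m)\<close> solves it.\<close>

lemma only_gf_Suc':
  assumes "l \<ge> 1" "\<forall>y\<in>set \<tau>. y < k"
  shows "only_gf l (Suc m) (\<tau> @ [k]) = fps_X * only_gf l m \<tau> * (avoid_gf l (Suc m))\<^sup>2"
  using only_gf_Suc[OF assms, of m] one_minus_mult_avoid_gf[of l m] by algebra

section \<open>Passage to Laurent series and Chebyshev polynomials\<close>

lemma series_at_x_mult: "series_at_x (f * g) = series_at_x f * series_at_x g"
  by (simp add: series_at_x_def fps_compose_mult_distrib fls_times_fps_to_fls)

lemma series_at_x_add: "series_at_x (f + g) = series_at_x f + series_at_x g"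
  by (simp add: series_at_x_def fps_compose_add_distrib)

lemma series_at_x_diff: "series_at_x (f - g) = series_at_x f - series_at_x g"
  by (simp add: series_at_x_def fps_compose_sub_distrib)

lemma series_at_x_const: "series_at_x (fps_const c) = fls_const c"
  by (simp add: series_at_x_def)

lemma series_at_x_0: "series_at_x 0 = 0" and series_at_x_1: "series_at_x 1 = 1"
  by (simp_all add: series_at_x_def)

lemma series_at_x_X: "series_at_x fps_X = var_x"
  by (simp add: series_at_x_def fps_to_fls_power)

lemma series_at_x_power: "series_at_x (f ^ n) = series_at_x f ^ n"
  by (induction n) (simp_all add: series_at_x_mult series_at_x_1)

lemma series_at_x_sum: "series_at_x (\<Sum>i\<in>A. f i) = (\<Sum>i\<in>A. series_at_x (f i))"
  using sum_comp_morphism[of series_at_x f A] by (simp add: series_at_x_0 series_at_x_add comp_def)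

lemma series_at_x_avoid_gf_0: "l \<ge> 1 \<Longrightarrow> series_at_x (avoid_gf l 0) = E l"
  by (simp add: avoid_gf_0 E_def series_at_x_sum series_at_x_mult series_at_x_const
      series_at_x_power series_at_x_X)

text \<open>The case distinction encodes the convention \<open>U\<^bsub>-1\<^esub> = 0\<close>.\<close>

definition cheb_denom :: "'a::field_char_0 \<Rightarrow> 'a \<Rightarrow> nat \<Rightarrow> 'a"
  where "cheb_denom t e m = chebyshev_U m (1 / (2 * t)) -
    (if m = 0 then 0 else t * e * chebyshev_U (m - 1) (1 / (2 * t)))"

lemma cheb_denom_0: "cheb_denom t e 0 = 1"
  by (simp add: cheb_denom_def)

lemma cheb_denom_1:
  assumes "t \<noteq> 0"
  shows "t * cheb_denom t e 1 = 1 - t\<^sup>2 * e"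
  using assms by (simp add: cheb_denom_def field_simps power2_eq_square)

text \<open>The Chebyshev recurrence is linear, so it passes to this combination of neighbouring
  polynomials; at the argument \<open>1 / (2 * t)\<close> its coefficient is 1/t, cleared by the
  factor \<open>t\<close>.\<close>

lemma cheb_denom_Suc_Suc:
  assumes "t \<noteq> 0"
  shows "t * cheb_denom t e (Suc (Suc m)) = cheb_denom t e (Suc m) - t * cheb_denom t e m"
proof -
  define u where "u = 1 / (2 * t)"
  have u: "2 * t * u = 1" using assms by (simp add: u_def)
  show ?thesis
  \<comment> \<open>At \<open>m = 0\<close> the combination reaches below index 0, where the
    convention replaces the recurrence, so this case is computed directly.\<close>
  proof (cases m)
    case 0
    have "t * (2 * u * (2 * u) - 1 - t * e * (2 * u)) = 2 * u - t * e - t"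
      using u by algebra
    then show ?thesis by (simp add: 0 cheb_denom_def flip: u_def)
  next
    case (Suc n)
    define a b where "a = chebyshev_U (Suc n) u" and "b = chebyshev_U n u"
    have "t * (2 * u * (2 * u * a - b) - a - t * e * (2 * u * a - b)) =
        2 * u * a - b - t * e * a - t * (a - t * e * b)"
      using u by algebra
    then show ?thesis by (simp add: Suc cheb_denom_def a_def b_def flip: u_def)
  qed
qed

abbreviation denom :: "nat \<Rightarrow> nat \<Rightarrow> rat fls"
  where "denom l \<equiv> cheb_denom sqrt_x (E l)"

text \<open>Each avoidance series is the inverse of 1 - xG for its predecessor G. This is a
  continued fraction whose successive denominators obey \<open>cheb_denom_Suc_Suc\<close>.\<close>

lemma avoid_gf_denom:
  assumes "l \<ge> 1"
  shows "series_at_x (avoid_gf l (Suc m)) * sqrt_x * denom l (Suc m) = denom l m"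
proof (induction m)
  have *: "series_at_x (avoid_gf l (Suc m)) * (1 - var_x * series_at_x (avoid_gf l m)) = 1" for m
    using arg_cong[OF one_minus_mult_avoid_gf[of l m], of series_at_x]
    by (simp add: series_at_x_mult series_at_x_diff series_at_x_1 series_at_x_X)
  {
    case 0
    show ?case
      using *[of 0] cheb_denom_1[OF fls_X_nonzero, of "E l"] by (simp add: series_at_x_avoid_gf_0[OF assms] cheb_denom_0 mult.assoc)
  next
    case (Suc m)
    define g h where "g = series_at_x (avoid_gf l (Suc m))" and "h = series_at_x (avoid_gf l (Suc (Suc m)))"
    have IH: "denom l m = g * sqrt_x * denom l (Suc m)" using Suc by (simp add: g_def)
    have "h * sqrt_x * denom l (Suc (Suc m)) = h * (denom l (Suc m) - sqrt_x * denom l m)"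
      by (simp only: mult.assoc cheb_denom_Suc_Suc[OF fls_X_nonzero])
    also have "\<dots> = h * (1 - var_x * g) * denom l (Suc m)"
      unfolding IH by (simp only: right_diff_distrib left_diff_distrib power2_eq_square mult_1_left mult_1_right mult_ac)
    also have "\<dots> = denom l (Suc m)"
      using *[of "Suc m"] by (simp add: g_def h_def)
    finally show ?case by (simp add: h_def)
  }
qed

text \<open>Peeling the last letter of \<tau> contributes x times the square of an avoidance series;
  by \<open>avoid_gf_denom\<close> this exactly offsets the change of squared denominator, leaving
  the value at \<open>m = 0\<close>.\<close>

lemma only_gf_denom:
  assumes "l \<ge> 1" "\<tau> \<in> pattern_set l (l + m)" "avoids \<tau> [1, 3, 2]"
  shows "series_at_x (only_gf l m \<tau>) * (denom l m)\<^sup>2 = var_x ^ l"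
  using assms(2,3)
proof (induction m arbitrary: \<tau>)
  case 0
  then have "\<tau> \<in> Av l" by (simp add: pattern_set_def Av_def)
  with assms(1) show ?case
    by (simp add: only_gf_0 cheb_denom_0 series_at_x_power series_at_x_X)
next
  case (Suc m)
  from Suc.prems(1) have \<tau>: "\<tau> \<in> perms (Suc (l + m))" "is_pat l (Suc m) \<tau>"
    unfolding pattern_set_iff by simp_all
  from \<tau>(2) obtain \<tau>' x where \<tau>': "\<tau> = \<tau>' @ [x]" "is_pat l m \<tau>'" "\<forall>y\<in>set \<tau>'. y < x"
    by (rule is_pat_SucE)
  have "x = Suc (l + m)"
    using \<tau>(1) \<tau>'(3) unfolding \<tau>'(1) by (rule snoc_max_perms)
  then have "\<tau>' \<in> perms (l + m)"
    using \<tau>(1) unfolding \<tau>'(1) by (simp only: snoc_perms_iff)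
  then have "\<tau>' \<in> pattern_set l (l + m)"
    using \<tau>'(2) by (simp add: pattern_set_iff)
  moreover have "avoids \<tau>' [1, 3, 2]"
    using Suc.prems(2) by (rule avoids_subseq) (simp add: \<tau>'(1) subseq_rev_drop_many)
  ultimately have IH: "series_at_x (only_gf l m \<tau>') * (denom l m)\<^sup>2 = var_x ^ l"
    by (rule Suc.IH)
  have "series_at_x (only_gf l (Suc m) \<tau>) =
      var_x * series_at_x (only_gf l m \<tau>') * (series_at_x (avoid_gf l (Suc m)))\<^sup>2"
    unfolding \<tau>'(1) only_gf_Suc'[OF assms(1) \<tau>'(3)]
    by (simp add: series_at_x_mult series_at_x_power series_at_x_X)
  then have "series_at_x (only_gf l (Suc m) \<tau>) * (denom l (Suc m))\<^sup>2 =
      series_at_x (only_gf l m \<tau>') * (series_at_x (avoid_gf l (Suc m)) * sqrt_x * denom l (Suc m))\<^sup>2"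
    by (simp add: power_mult_distrib mult_ac)
  with IH show ?case unfolding avoid_gf_denom[OF assms(1)] by simp
qed

theorem corollary3:
  fixes k l :: nat and \<tau> :: "nat list"
  assumes "k > l" and "l \<ge> 1"
    and "\<tau> \<in> pattern_set l k" and "avoids \<tau> [1, 3, 2]"
  shows "series_at_x (F (pattern_set l k - {\<tau>}) \<tau>) =
    var_x ^ l /
      (chebyshev_U (k - l) (1 / (2 * sqrt_x))
        - sqrt_x * E l * chebyshev_U (k - 1 - l) (1 / (2 * sqrt_x))) ^ 2"
proof -
  define m where "m = k - l"
  have k: "k = l + m" and m: "m \<noteq> 0" "k - 1 - l = m - 1"
    using assms(1) by (simp_all add: m_def)
  have \<tau>: "\<tau> \<in> pattern_set l (l + m)" using assms(3) by (simp add: k)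
  have *: "series_at_x (F (pattern_set l k - {\<tau>}) \<tau>) * (denom l m)\<^sup>2 = var_x ^ l"
    unfolding k F_eq_only_gf[OF \<tau>] by (rule only_gf_denom[OF assms(2) \<tau> assms(4)])
  \<comment> \<open>A zero denominator would make the nonzero power of \<open>var_x\<close>
    vanish.\<close>
  then have "denom l m \<noteq> 0" by (metis fls_X_nonzero mult_zero_right power_not_zero zero_power2)
  with * have "series_at_x (F (pattern_set l k - {\<tau>}) \<tau>) = var_x ^ l / (denom l m)\<^sup>2"
    by (simp add: field_simps)
  then show ?thesis
    using m by (simp add: cheb_denom_def m_def)
qed

end
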